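(* Let $(X,d)$ be a proper geodesic metric space. Then the metric compactification $(\overline{X}^d,i_d)$ is a good compactification of $(X,d)$.
   Context: A metric space is proper if its closed bounded sets are compact, and geodesic if any two points are joined by a geodesic (an isometric embedding of a compact interval). Metric compactification of $(X,d)$: let $C(X)$ be the space of real-valued continuous functions on $X$ with the topology of local uniform convergence, and let $C_*(X)$ be the quotient of $C(X)$ by the constant functions, with the quotient topology; write $[f]$ for the class of $f$. Define $i_d:X\to C_*(X)$ by $i_d(x)=[d(x,\cdot)]$. The metric compactification $\overline{X}^d$ is the closure of $i_d(X)$ in $C_*(X)$. Compactification: a pair $(\iota,X^* )$ (also written $(X^*,\iota)$) is a compactification of $X$ if $X^*$ is a sequentially compact Hausdorff topological space, $\iota:X\to X^*$ is a homeomorphism onto its image, and $\iota(X)$ is open and dense in $X^*$. Good compactification: a compactification $(\iota,X^* )$ of a geodesic metric space $(X,d)$ is good if for every sequence of geodesics $\sigma_n:[a_n,b_n]\to X$ such that $\lim_{n\to\infty}\iota(\sigma_n(a_n))$ and $\lim_{n\to\infty}\iota(\sigma_n(b_n))$ exist, are equal, and lie in $X^*\setminus\iota(X)$, we have $\liminf_{n\to\infty} d(o,\sigma_n)=\infty$ for any $o\in X$, where $d(o,\sigma_n)=\inf_{t\in[a_n,b_n]}d(o,\sigma_n(t))$. *)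

theory Defs
  imports "HOL-Analysis.Analysis"
begin

text \<open>Degenerate intervals (\<open>a = b\<close>) are allowed.\<close>

definition geodesic :: "real \<Rightarrow> real \<Rightarrow> (real \<Rightarrow> 'a::metric_space) \<Rightarrow> bool" where
  "geodesic a b \<sigma> \<longleftrightarrow>
     a \<le> b \<and> (\<forall>s\<in>{a..b}. \<forall>t\<in>{a..b}. dist (\<sigma> s) (\<sigma> t) = \<bar>s - t\<bar>)"

definition sequentially_compact_space :: "'b topology \<Rightarrow> bool" where
  "sequentially_compact_space T \<longleftrightarrow>
     (\<forall>s :: nat \<Rightarrow> 'b. (\<forall>n. s n \<in> topspace T) \<longrightarrow>
        (\<exists>l r. strict_mono r \<and> limitin T (s \<circ> r) l sequentially))"

definition compactification :: "'b topology \<Rightarrow> ('a::metric_space \<Rightarrow> 'b) \<Rightarrow> bool" where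
  "compactification T \<iota> \<longleftrightarrow>
     sequentially_compact_space T \<and> Hausdorff_space T \<and>
     embedding_map euclidean T \<iota> \<and>
     openin T (range \<iota>) \<and> T closure_of (range \<iota>) = topspace T"

definition good_compactification :: "'b topology \<Rightarrow> ('a::metric_space \<Rightarrow> 'b) \<Rightarrow> bool" where
  "good_compactification T \<iota> \<longleftrightarrow>
     compactification T \<iota> \<and>
     (\<forall>(a :: nat \<Rightarrow> real) (b :: nat \<Rightarrow> real) (\<sigma> :: nat \<Rightarrow> real \<Rightarrow> 'a) \<xi>.
        (\<forall>n. geodesic (a n) (b n) (\<sigma> n)) \<and>
        limitin T (\<lambda>n. \<iota> (\<sigma> n (a n))) \<xi> sequentially \<and>
        limitin T (\<lambda>n. \<iota> (\<sigma> n (b n))) \<xi> sequentially \<and>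
        \<xi> \<in> topspace T - range \<iota> \<longrightarrow>
        (\<forall>p :: 'a. liminf (\<lambda>n. ereal (INF t\<in>{a n..b n}. dist p (\<sigma> n t))) = \<infinity>))"

text \<open>
  The topology on the continuous functions is that of uniform convergence on compact sets.
  On a proper space this is the topology of local uniform convergence; see
  \<open>limitin_cfun_topology_locally\<close> below, which identifies its convergent filters.
\<close>

definition cfun :: "('a::metric_space \<Rightarrow> real) set" where
  "cfun = {f. continuous_on UNIV f}"

definition cfun_topology :: "('a::metric_space \<Rightarrow> real) topology" where
  "cfun_topology = topology (\<lambda>U. U \<subseteq> cfun \<and>
     (\<forall>f\<in>U. \<exists>K e. compact K \<and> e > 0 \<and> {g\<in>cfun. \<forall>x\<in>K. dist (g x) (f x) < e} \<subseteq> U))"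

definition const_rel :: "(('a::metric_space \<Rightarrow> real) \<times> ('a \<Rightarrow> real)) set" where
  "const_rel = {(f, g). f \<in> cfun \<and> g \<in> cfun \<and> (\<exists>c. \<forall>x. g x = f x + c)}"

definition cfun_class :: "('a::metric_space \<Rightarrow> real) \<Rightarrow> ('a \<Rightarrow> real) set" where
  "cfun_class f = const_rel `` {f}"

definition cfun_quotient_topology :: "('a::metric_space \<Rightarrow> real) set topology" where
  "cfun_quotient_topology = topology (\<lambda>U. U \<subseteq> cfun // const_rel \<and>
     openin cfun_topology {f\<in>cfun. cfun_class f \<in> U})"

definition metric_embedding :: "'a::metric_space \<Rightarrow> ('a \<Rightarrow> real) set" where
  "metric_embedding x = cfun_class (\<lambda>y. dist x y)"

definition metric_compactification :: "('a::metric_space \<Rightarrow> real) set topology" where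
  "metric_compactification =
     subtopology cfun_quotient_topology
       (cfun_quotient_topology closure_of (range metric_embedding))"

lemma openin_cfun_topology:
  fixes U :: "('a::metric_space \<Rightarrow> real) set"
  shows "openin cfun_topology U \<longleftrightarrow> U \<subseteq> cfun \<and>
     (\<forall>f\<in>U. \<exists>K e. compact K \<and> e > 0 \<and> {g\<in>cfun. \<forall>x\<in>K. dist (g x) (f x) < e} \<subseteq> U)"
proof -
  let ?nb = "\<lambda>(f :: 'a \<Rightarrow> real) K e. {g\<in>cfun. \<forall>x\<in>K. dist (g x) (f x) < e}"
  have "istopology (\<lambda>U. U \<subseteq> cfun \<and> (\<forall>f\<in>U. \<exists>K e. compact K \<and> e > 0 \<and> ?nb f K e \<subseteq> U))"
    unfolding istopology_def
  proof (rule conjI; intro allI impI conjI ballI)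
    fix S T :: "('a \<Rightarrow> real) set"
    assume "S \<subseteq> cfun \<and> (\<forall>f\<in>S. \<exists>K e. compact K \<and> e > 0 \<and> ?nb f K e \<subseteq> S)"
    then have "S \<subseteq> cfun" by (rule conjunct1)
    then show "S \<inter> T \<subseteq> cfun" by (rule le_infI1)
  next
    fix S T :: "('a \<Rightarrow> real) set" and f
    assume "S \<subseteq> cfun \<and> (\<forall>f\<in>S. \<exists>K e. compact K \<and> e > 0 \<and> ?nb f K e \<subseteq> S)"
      and "T \<subseteq> cfun \<and> (\<forall>f\<in>T. \<exists>K e. compact K \<and> e > 0 \<and> ?nb f K e \<subseteq> T)"
      and f: "f \<in> S \<inter> T"
    note A = this
    have S: "\<forall>f\<in>S. \<exists>K e. compact K \<and> e > 0 \<and> ?nb f K e \<subseteq> S"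
      and T: "\<forall>f\<in>T. \<exists>K e. compact K \<and> e > 0 \<and> ?nb f K e \<subseteq> T"
      using A(1,2)[THEN conjunct2] .
    from f have "f \<in> S" "f \<in> T" by simp_all
    from bspec[OF S this(1)] bspec[OF T this(2)] obtain K e L d where
      1: "compact K" "e > 0" "?nb f K e \<subseteq> S" and 2: "compact L" "d > 0" "?nb f L d \<subseteq> T"
      by (elim exE conjE)
    have "?nb f (K \<union> L) (min e d) \<subseteq> ?nb f K e \<inter> ?nb f L d"
      by auto
    also have "\<dots> \<subseteq> S \<inter> T" using 1(3) 2(3) by (rule Int_mono)
    finally have "?nb f (K \<union> L) (min e d) \<subseteq> S \<inter> T" .
    moreover have "compact (K \<union> L)" "min e d > 0" using 1 2 by auto
    ultimately show "\<exists>K e. compact K \<and> e > 0 \<and> ?nb f K e \<subseteq> S \<inter> T"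
      by (intro exI conjI)
  next
    fix \<K> :: "('a \<Rightarrow> real) set set"
    assume "\<forall>U\<in>\<K>. U \<subseteq> cfun \<and> (\<forall>f\<in>U. \<exists>K e. compact K \<and> e > 0 \<and> ?nb f K e \<subseteq> U)"
    note A = this
    show "\<Union>\<K> \<subseteq> cfun" by (rule Union_least) (rule bspec[OF A, THEN conjunct1])
  next
    fix \<K> :: "('a \<Rightarrow> real) set set" and f
    assume A: "\<forall>U\<in>\<K>. U \<subseteq> cfun \<and> (\<forall>f\<in>U. \<exists>K e. compact K \<and> e > 0 \<and> ?nb f K e \<subseteq> U)"
      and "f \<in> \<Union>\<K>"
    from \<open>f \<in> \<Union>\<K>\<close> obtain U where U: "U \<in> \<K>" "f \<in> U" by (rule UnionE)
    from bspec[OF bspec[OF A U(1), THEN conjunct2] U(2)]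
    obtain K e where K: "compact K" "e > 0" "?nb f K e \<subseteq> U" by (elim exE conjE)
    have "U \<subseteq> \<Union>\<K>" using U(1) by (rule Union_upper)
    with K(3) have "?nb f K e \<subseteq> \<Union>\<K>" by (rule subset_trans)
    with K(1,2) show "\<exists>K e. compact K \<and> e > 0 \<and> ?nb f K e \<subseteq> \<Union>\<K>" by (intro exI conjI)
  qed
  then show ?thesis
    unfolding cfun_topology_def by simp
qed

lemma topspace_cfun_topology [simp]:
  "topspace cfun_topology = (cfun :: ('a::metric_space \<Rightarrow> real) set)"
proof (rule subset_antisym)
  have "openin cfun_topology (topspace cfun_topology :: ('a \<Rightarrow> real) set)" by (rule openin_topspace)
  then show "topspace cfun_topology \<subseteq> (cfun :: ('a \<Rightarrow> real) set)"
    unfolding openin_cfun_topology by (rule conjunct1)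
  have "openin cfun_topology (cfun :: ('a \<Rightarrow> real) set)"
    unfolding openin_cfun_topology by (auto intro!: exI[of _ "{}"] exI[of _ 1])
  then show "cfun \<subseteq> (topspace cfun_topology :: ('a \<Rightarrow> real) set)"
    by (rule openin_subset)
qed

lemma limitin_cfun_topology:
  fixes f :: "'i \<Rightarrow> 'a::metric_space \<Rightarrow> real"
  assumes "\<And>n. f n \<in> cfun" "l \<in> cfun"
  shows "limitin cfun_topology f l F \<longleftrightarrow> (\<forall>K. compact K \<longrightarrow> uniform_limit K f l F)"
proof
  assume L: "limitin cfun_topology f l F"
  show "\<forall>K. compact K \<longrightarrow> uniform_limit K f l F"
  proof (intro allI impI, rule uniform_limitI)
    fix K :: "'a set" and e :: real
    assume K: "compact K" and e: "e > 0"
    let ?U = "{g\<in>cfun. \<forall>x\<in>K. dist (g x) (l x) < e}"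
    have "\<exists>K' e'. compact K' \<and> e' > 0 \<and> {h\<in>cfun. \<forall>x\<in>K'. dist (h x) (g x) < e'} \<subseteq> ?U"
      if g: "g \<in> ?U" for g
    proof (cases "K = {}")
      case True
      then show ?thesis using e by (intro exI[of _ "{}"] exI[of _ e]) auto
    next
      case False
      have "continuous_on K (\<lambda>x. dist (g x) (l x))"
        using g assms(2) unfolding cfun_def
        by (auto intro!: continuous_intros intro: continuous_on_subset)
      then obtain z where z: "z \<in> K" "\<forall>x\<in>K. dist (g x) (l x) \<le> dist (g z) (l z)"
        using continuous_attains_sup[OF K False] by blast
      define e' where "e' = e - dist (g z) (l z)"
      have "e' > 0" using g z unfolding e'_def by auto
      moreover have "dist (h x) (l x) < e" if "x \<in> K" "dist (h x) (g x) < e'" for h x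
        using that z(2) dist_triangle[of "h x" "l x" "g x"] unfolding e'_def by fastforce
      ultimately show ?thesis using K by (intro exI[of _ K] exI[of _ e']) auto
    qed
    then have "openin cfun_topology ?U" unfolding openin_cfun_topology by auto
    moreover have "l \<in> ?U" using assms e by auto
    ultimately have "eventually (\<lambda>n. f n \<in> ?U) F" using L unfolding limitin_def by blast
    then show "eventually (\<lambda>n. \<forall>x\<in>K. dist (f n x) (l x) < e) F"
      by (rule eventually_mono) auto
  qed
next
  assume R: "\<forall>K. compact K \<longrightarrow> uniform_limit K f l F"
  show "limitin cfun_topology f l F"
    unfolding limitin_def
  proof (intro conjI allI impI; (elim conjE)?)
    fix U assume U: "openin cfun_topology U" "l \<in> U"
    then obtain K e where K: "compact K" "e > 0"
      and sub: "{g\<in>cfun. \<forall>x\<in>K. dist (g x) (l x) < e} \<subseteq> U"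
      unfolding openin_cfun_topology by blast
    have "eventually (\<lambda>n. \<forall>x\<in>K. dist (f n x) (l x) < e) F"
      using R K by (auto intro: uniform_limitD)
    then show "eventually (\<lambda>n. f n \<in> U) F"
      by (rule eventually_mono) (use sub assms(1) in auto)
  qed (use assms in auto)
qed

lemma limitin_cfun_topology_locally:
  fixes f :: "'i \<Rightarrow> 'a::metric_space \<Rightarrow> real"
  assumes proper: "\<And>S :: 'a set. closed S \<Longrightarrow> bounded S \<Longrightarrow> compact S"
    and "\<And>n. f n \<in> cfun" "l \<in> cfun"
  shows "limitin cfun_topology f l F \<longleftrightarrow>
    (\<forall>x. \<exists>U. open U \<and> x \<in> U \<and> uniform_limit U f l F)"
  unfolding limitin_cfun_topology[OF assms(2,3)]
proof
  assume R: "\<forall>K. compact K \<longrightarrow> uniform_limit K f l F"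
  show "\<forall>x. \<exists>U. open U \<and> x \<in> U \<and> uniform_limit U f l F"
  proof
    fix x :: 'a
    have "uniform_limit (cball x 1) f l F" using R proper by auto
    then have "uniform_limit (ball x 1) f l F"
      by (rule uniform_limit_on_subset) auto
    then show "\<exists>U. open U \<and> x \<in> U \<and> uniform_limit U f l F"
      by (intro exI[of _ "ball x 1"]) auto
  qed
next
  assume "\<forall>x. \<exists>U. open U \<and> x \<in> U \<and> uniform_limit U f l F"
  then obtain U where U: "\<And>x. open (U x)" "\<And>x. x \<in> U x" "\<And>x. uniform_limit (U x) f l F"
    by metis
  show "\<forall>K. compact K \<longrightarrow> uniform_limit K f l F"
  proof (intro allI impI)
    fix K :: "'a set" assume "compact K"
    then obtain D where D: "D \<subseteq> K" "finite D" "K \<subseteq> (\<Union>x\<in>D. U x)"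
      using U by (elim compactE_image[of K K U]) auto
    have "uniform_limit (\<Union>x\<in>D. U x) f l F"
      using D U by (intro uniform_limit_on_UNION) auto
    then show "uniform_limit K f l F" using D(3) by (rule uniform_limit_on_subset)
  qed
qed

lemma equiv_const_rel: "equiv (cfun :: ('a::metric_space \<Rightarrow> real) set) const_rel"
proof (rule equivI)
  show "refl_on (cfun :: ('a \<Rightarrow> real) set) const_rel"
    unfolding refl_on_def const_rel_def by (auto intro: exI[of _ 0])
  show "sym (const_rel :: (('a \<Rightarrow> real) \<times> ('a \<Rightarrow> real)) set)"
  proof (rule symI)
    fix f g :: "'a \<Rightarrow> real" assume "(f, g) \<in> const_rel"
    then obtain c where "f \<in> cfun" "g \<in> cfun" "\<forall>x. g x = f x + c"
      unfolding const_rel_def by auto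
    then show "(g, f) \<in> const_rel" unfolding const_rel_def by (auto intro!: exI[of _ "- c"])
  qed
  show "trans (const_rel :: (('a \<Rightarrow> real) \<times> ('a \<Rightarrow> real)) set)"
  proof (rule transI)
    fix f g h :: "'a \<Rightarrow> real" assume "(f, g) \<in> const_rel" "(g, h) \<in> const_rel"
    then obtain c d where "f \<in> cfun" "h \<in> cfun" "\<forall>x. g x = f x + c" "\<forall>x. h x = g x + d"
      unfolding const_rel_def by auto
    then show "(f, h) \<in> const_rel" unfolding const_rel_def by (auto intro!: exI[of _ "c + d"])
  qed
qed (auto simp: const_rel_def)

lemma quotient_map_cfun_class:
  "quotient_map (cfun_topology :: ('a::metric_space \<Rightarrow> real) topology)
     cfun_quotient_topology cfun_class"
proof -
  let ?pre = "\<lambda>U. {f :: 'a \<Rightarrow> real. f \<in> cfun \<and> cfun_class f \<in> U}"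
  have "istopology (\<lambda>U. U \<subseteq> cfun // const_rel \<and> openin cfun_topology (?pre U))"
    unfolding istopology_def
  proof (rule conjI; intro allI impI conjI)
    fix S T :: "('a \<Rightarrow> real) set set"
    assume S: "S \<subseteq> cfun // const_rel \<and> openin cfun_topology (?pre S)"
      and T: "T \<subseteq> cfun // const_rel \<and> openin cfun_topology (?pre T)"
    show "S \<inter> T \<subseteq> cfun // const_rel" using S[THEN conjunct1] by (rule le_infI1)
    have "?pre (S \<inter> T) = ?pre S \<inter> ?pre T" by auto
    then show "openin cfun_topology (?pre (S \<inter> T))"
      using openin_Int[OF S[THEN conjunct2] T[THEN conjunct2]] by simp
  next
    fix \<K> :: "('a \<Rightarrow> real) set set set"
    assume A: "\<forall>U\<in>\<K>. U \<subseteq> cfun // const_rel \<and> openin cfun_topology (?pre U)"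
    show "\<Union>\<K> \<subseteq> cfun // const_rel"
      by (rule Union_least) (rule A[THEN bspec, THEN conjunct1])
    have "openin cfun_topology (\<Union>U\<in>\<K>. ?pre U)"
      by (rule openin_clauses(3)) (use A in blast)
    moreover have "?pre (\<Union>\<K>) = (\<Union>U\<in>\<K>. ?pre U)" by auto
    ultimately show "openin cfun_topology (?pre (\<Union>\<K>))" by simp
  qed
  then have opn: "openin cfun_quotient_topology U \<longleftrightarrow>
      U \<subseteq> cfun // const_rel \<and> openin cfun_topology (?pre U)" for U
    unfolding cfun_quotient_topology_def by simp
  have im: "cfun_class ` (cfun :: ('a \<Rightarrow> real) set) = cfun // const_rel"
    unfolding cfun_class_def quotient_def by auto
  have pre: "?pre (cfun // const_rel) = cfun" using im by auto
  have "openin cfun_topology (cfun :: ('a \<Rightarrow> real) set)"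
    using openin_topspace[of cfun_topology] by (simp only: topspace_cfun_topology)
  then have "openin cfun_quotient_topology (cfun // const_rel :: ('a \<Rightarrow> real) set set)"
    unfolding opn pre by (intro conjI order_refl)
  moreover have "topspace cfun_quotient_topology \<subseteq> (cfun // const_rel :: ('a \<Rightarrow> real) set set)"
    using opn[of "topspace cfun_quotient_topology"] openin_topspace by (rule iffD1[THEN conjunct1])
  ultimately have top: "topspace cfun_quotient_topology = (cfun // const_rel :: ('a \<Rightarrow> real) set set)"
    by (intro subset_antisym openin_subset)
  show ?thesis
    unfolding quotient_map_def topspace_cfun_topology top opn
    by (intro conjI allI impI im) (simp only: simp_thms)
qed

end

theory Submission
  imports Defs "HOL-Complex_Analysis.Great_Picard"
begin

text \<open>
  A class \<open>[g]\<close> modulo constants is the same thing as the family of increments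
  \<open>g z - g p\<close>, so the quotient topology is handled through the neighbourhoods that control
  these increments over a compact set of points \<open>z\<close> (\<open>increment_nbhd\<close>). They separate
  classes, which gives the Hausdorff property, and they show that \<open>\<bar>g x - g y\<bar> \<le> dist x y\<close>
  passes from distance functions to the closure of their classes. Hence the points of the
  metric compactification are classes of 1-Lipschitz functions; normalised to vanish at a base
  point these form a pointwise bounded equicontinuous family on a separable space, and the
  Arzela-Ascoli argument yields sequential compactness.

  The geometry enters through one observation: on the geodesic from a far away point \<open>x\<close> to
  a point \<open>z\<close>, a step from \<open>z\<close> towards \<open>x\<close> decreases \<open>dist x\<close> at unit speed. It is used
  twice.

  \<^item> If the increments of \<open>dist y\<close> are uniformly close to those of \<open>dist x\<close> on a ball about
    \<open>x\<close>, then \<open>y\<close> lies in this ball, since otherwise \<open>dist y\<close> would decrease on the way from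
    \<open>x\<close> to \<open>y\<close> while \<open>dist x\<close> increases (\<open>metric_compactification_local\<close>). As the image of
    a closed ball is compact, no limit of other classes can appear near \<open>[dist x]\<close>, so the
    embedding is open into the compactification.

  \<^item> Let the endpoints \<open>x\<close>, \<open>y\<close> of a geodesic both have increments close to those of one
    function \<open>h\<close> on a ball, and let \<open>x\<close> be far away. If the geodesic met a smaller ball at
    \<open>z\<close>, a unit step from \<open>z\<close> towards \<open>x\<close> would decrease \<open>dist x\<close> by one and hence, up to
    a small error, \<open>dist y\<close> as well. The sum of the two distances would drop below
    \<open>dist x z + dist z y = dist x y\<close>, against the triangle inequality
    (\<open>geodesic_between_close_increments_far\<close>). Endpoint sequences with the same limit at
    infinity eventually satisfy this for every radius, so the geodesics leave every ball.
\<close>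

section \<open>Classes of functions modulo constants\<close>

lemma cfun_class_eq_iff:
  assumes "f \<in> cfun" "g \<in> cfun"
  shows "cfun_class f = cfun_class g \<longleftrightarrow> (\<exists>c. \<forall>x. g x = f x + c)"
  using eq_equiv_class_iff[OF equiv_const_rel assms] assms
  unfolding cfun_class_def by (simp add: const_rel_def)

lemma topspace_cfun_quotient: "topspace cfun_quotient_topology = cfun_class ` cfun"
  by (simp add: quotient_imp_surjective_map[OF quotient_map_cfun_class, symmetric])

lemma cfun_translate: "f \<in> cfun \<Longrightarrow> (\<lambda>z. f z + c) \<in> cfun"
  unfolding cfun_def by (simp add: continuous_on_add)

lemma dist_in_cfun: "(\<lambda>y. dist x y) \<in> cfun"
  unfolding cfun_def by (auto intro!: continuous_intros)

lemma lipschitz_in_cfun: "1-lipschitz_on UNIV f \<Longrightarrow> f \<in> cfun"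
  unfolding cfun_def using lipschitz_on_continuous_on by blast

text \<open>
  Comparing increments from \<open>p\<close> instead of values makes the condition independent of the
  representative, so that a class belongs to the set if and only if each of its members satisfies it.
\<close>

definition increment_nbhd ::
  "'a::metric_space \<Rightarrow> 'a set \<Rightarrow> real \<Rightarrow> ('a \<Rightarrow> real) \<Rightarrow> ('a \<Rightarrow> real) set set" where
  "increment_nbhd p K e f =
     cfun_class ` {g\<in>cfun. \<forall>z\<in>K. dist (g z - g p) (f z - f p) < e}"

lemma cfun_class_in_increment_nbhd:
  assumes "g \<in> cfun"
  shows "cfun_class g \<in> increment_nbhd p K e f \<longleftrightarrow> (\<forall>z\<in>K. dist (g z - g p) (f z - f p) < e)"
proof
  assume "cfun_class g \<in> increment_nbhd p K e f"
  then obtain h where h: "h \<in> cfun" "\<forall>z\<in>K. dist (h z - h p) (f z - f p) < e"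
    and "cfun_class g = cfun_class h"
    unfolding increment_nbhd_def by auto
  then obtain c where "\<forall>x. h x = g x + c"
    using cfun_class_eq_iff[OF assms h(1)] by auto
  with h(2) show "\<forall>z\<in>K. dist (g z - g p) (f z - f p) < e" by simp
qed (use assms in \<open>auto simp: increment_nbhd_def\<close>)

text \<open>
  Because \<open>K\<close> is compact, the largest deviation of the increments is attained and leaves a
  positive margin below \<open>e\<close>.
\<close>

lemma openin_increment_nbhd:
  fixes f :: "'a::metric_space \<Rightarrow> real"
  assumes K: "compact K" and f: "f \<in> cfun"
  shows "openin cfun_quotient_topology (increment_nbhd p K e f)"
proof -
  let ?V = "{g\<in>cfun. \<forall>z\<in>K. dist (g z - g p) (f z - f p) < e}"
  have "\<exists>L d. compact L \<and> d > 0 \<and> {h\<in>cfun. \<forall>x\<in>L. dist (h x) (g x) < d} \<subseteq> ?V"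
    if g: "g \<in> ?V" for g
  proof (cases "K = {}")
    case True
    then show ?thesis by (intro exI[of _ "{}"] exI[of _ 1]) auto
  next
    case False
    have "continuous_on K (\<lambda>z. dist (g z - g p) (f z - f p))"
      using g f unfolding cfun_def
      by (auto intro!: continuous_intros intro: continuous_on_subset)
    then obtain w where w: "w \<in> K"
      "\<forall>z\<in>K. dist (g z - g p) (f z - f p) \<le> dist (g w - g p) (f w - f p)"
      using continuous_attains_sup[OF K False] by blast
    \<comment> \<open>Half of the margin, as an increment involves the two values at \<open>z\<close> and at \<open>p\<close>.\<close>
    define d where "d = (e - dist (g w - g p) (f w - f p)) / 2"
    have "d > 0" using g w(1) unfolding d_def by auto
    moreover have "dist (h z - h p) (f z - f p) < e"
      if "z \<in> K" "dist (h z) (g z) < d" "dist (h p) (g p) < d" for h z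
    proof -
      have "dist (g z - g p) (f z - f p) \<le> e - 2 * d"
        using w(2) that(1) unfolding d_def by (simp add: field_simps)
      with that(2,3) show ?thesis unfolding dist_real_def by linarith
    qed
    ultimately show ?thesis
      using K by (intro exI[of _ "insert p K"] exI[of _ d]) auto
  qed
  then have "openin cfun_topology ?V" unfolding openin_cfun_topology by auto
  moreover have "{g\<in>cfun. cfun_class g \<in> increment_nbhd p K e f} = ?V"
    using cfun_class_in_increment_nbhd by blast
  moreover have "increment_nbhd p K e f \<subseteq> topspace cfun_quotient_topology"
    unfolding topspace_cfun_quotient increment_nbhd_def by auto
  ultimately show ?thesis
    using quotient_map_cfun_class[unfolded quotient_map_def, THEN conjunct2, rule_format,
        of "increment_nbhd p K e f"] by simp
qed

text \<open>
  Two classes differ exactly if some increment from \<open>p\<close> differs, and a single increment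
  is already enough to separate them.
\<close>

lemma Hausdorff_cfun_quotient:
  "Hausdorff_space (cfun_quotient_topology :: ('a::metric_space \<Rightarrow> real) set topology)"
  unfolding Hausdorff_space_def
proof (intro allI impI; elim conjE)
  fix \<xi> \<eta> :: "('a \<Rightarrow> real) set"
  assume "\<xi> \<in> topspace cfun_quotient_topology" "\<eta> \<in> topspace cfun_quotient_topology"
    and ne: "\<xi> \<noteq> \<eta>"
  then obtain f g where f: "f \<in> cfun" "\<xi> = cfun_class f" and g: "g \<in> cfun" "\<eta> = cfun_class g"
    unfolding topspace_cfun_quotient by auto
  fix p :: 'a
  obtain z where z: "g z - g p \<noteq> f z - f p"
  proof (rule ccontr)
    assume "\<not> thesis"
    then have "\<forall>z. g z = f z + (g p - f p)" using that by (auto simp: algebra_simps)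
    with cfun_class_eq_iff[OF f(1) g(1)] f g ne show False by blast
  qed
  define e where "e = dist (g z - g p) (f z - f p) / 2"
  have "e > 0" using z unfolding e_def by simp
  have "disjnt (increment_nbhd p {z} e f) (increment_nbhd p {z} e g)"
  proof -
    have "\<not> dist (h z - h p) (g z - g p) < e" if "dist (h z - h p) (f z - f p) < e" for h
      using that dist_triangle3[of "g z - g p" "f z - f p" "h z - h p"]
      unfolding e_def by simp
    then have "cfun_class h \<notin> increment_nbhd p {z} e g"
      if "h \<in> cfun" "dist (h z - h p) (f z - f p) < e" for h
      using that by (simp add: cfun_class_in_increment_nbhd)
    then show ?thesis
      unfolding disjnt_iff increment_nbhd_def[of p "{z}" e f] by auto
  qed
  moreover have "\<xi> \<in> increment_nbhd p {z} e f" "\<eta> \<in> increment_nbhd p {z} e g"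
    using f g \<open>e > 0\<close> by (auto simp: cfun_class_in_increment_nbhd)
  ultimately show "\<exists>U V. openin cfun_quotient_topology U \<and> openin cfun_quotient_topology V
      \<and> \<xi> \<in> U \<and> \<eta> \<in> V \<and> disjnt U V"
    using openin_increment_nbhd[OF _ f(1), of "{z}"] openin_increment_nbhd[OF _ g(1), of "{z}"]
    by (intro exI[of _ "increment_nbhd p {z} e f"] exI[of _ "increment_nbhd p {z} e g"]) simp
qed

section \<open>The embedding by distance functions\<close>

text \<open>
  By the triangle inequality, \<open>dist x\<close> and \<open>dist y\<close> differ by at most \<open>dist x y\<close> on the whole
  space, so the map is continuous even before passing to the quotient.
\<close>

lemma continuous_metric_embedding:
  "continuous_map euclidean cfun_quotient_topology (metric_embedding :: 'a::metric_space \<Rightarrow> _)"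
proof -
  have "continuous_map euclidean cfun_topology (\<lambda>x :: 'a. \<lambda>y. dist x y)"
    unfolding continuous_map
  proof (intro conjI allI impI)
    show "(\<lambda>(x :: 'a) y. dist x y) ` topspace euclidean \<subseteq> topspace cfun_topology"
      using dist_in_cfun by auto
    fix U :: "('a \<Rightarrow> real) set" assume U: "openin cfun_topology U"
    have "\<exists>e>0. ball x e \<subseteq> {x. dist x \<in> U}" if x: "dist x \<in> U" for x
    proof -
      from U x obtain K e where e: "e > 0" and K: "{g\<in>cfun. \<forall>y\<in>K. dist (g y) (dist x y) < e} \<subseteq> U"
        unfolding openin_cfun_topology by blast
      have "dist y \<in> U" if "dist x y < e" for y
      proof -
        have "dist (dist y z) (dist x z) < e" for z
          using that dist_triangle[of x z y] dist_triangle[of y z x]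
          unfolding dist_real_def by (simp add: dist_commute)
        then show ?thesis using K dist_in_cfun[of y] by blast
      qed
      then show ?thesis using e by (intro exI[of _ e]) auto
    qed
    then have "open {x :: 'a. dist x \<in> U}" unfolding open_contains_ball by auto
    then show "openin euclidean {x \<in> topspace euclidean. dist (x :: 'a) \<in> U}" by simp
  qed
  from continuous_map_compose[OF this quotient_imp_continuous_map[OF quotient_map_cfun_class]]
  show ?thesis unfolding metric_embedding_def o_def .
qed

lemma inj_metric_embedding: "inj (metric_embedding :: 'a::metric_space \<Rightarrow> _)"
proof (rule injI)
  fix x y :: 'a assume "metric_embedding x = metric_embedding y"
  then obtain c where "\<forall>z. dist y z = dist x z + c"
    unfolding metric_embedding_def cfun_class_eq_iff[OF dist_in_cfun dist_in_cfun] by blast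
  then have "dist y x = dist x x + c" "dist y y = dist x y + c" by blast+
  then show "x = y" by (simp add: dist_commute)
qed

lemma metric_embedding_in_increment_nbhd:
  "metric_embedding x \<in> increment_nbhd p K e f
     \<longleftrightarrow> (\<forall>z\<in>K. dist (dist x z - dist x p) (f z - f p) < e)"
  unfolding metric_embedding_def by (rule cfun_class_in_increment_nbhd[OF dist_in_cfun])

text \<open>
  This is how classes at infinity are kept away from bounded sets: in a proper space it applies
  to closed balls.
\<close>

lemma closedin_metric_embedding_image:
  fixes K :: "'a::metric_space set"
  assumes "compact K"
  shows "closedin cfun_quotient_topology (metric_embedding ` K)"
  by (rule compactin_imp_closedin[OF Hausdorff_cfun_quotient
        image_compactin[OF _ continuous_metric_embedding]]) (use assms in simp)

section \<open>Sequential compactness\<close>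

lemma proper_imp_separable:
  fixes p :: "'a::metric_space"
  assumes proper: "\<And>S :: 'a set. closed S \<Longrightarrow> bounded S \<Longrightarrow> compact S"
  shows "\<exists>D :: 'a set. countable D \<and> closure D = UNIV"
proof -
  \<comment> \<open>Finite nets of the balls about \<open>p\<close>, at every scale.\<close>
  have "\<exists>k. finite k \<and> cball p (real n) \<subseteq> (\<Union>x\<in>k. ball x (1 / Suc m))" for n m :: nat
    using seq_compact_imp_totally_bounded[OF compact_imp_seq_compact[OF proper[OF closed_cball bounded_cball]],
        rule_format, of "1 / Suc m" p "real n"] by auto
  then obtain k where k: "\<And>n m. finite (k n m)"
    "\<And>n m. cball p (real n) \<subseteq> (\<Union>x\<in>k n m. ball x (1 / Suc m))"
    by metis
  let ?D = "\<Union>n m. k n m"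
  have "x \<in> closure ?D" for x
    unfolding closure_approachable
  proof (intro allI impI)
    fix e :: real assume "e > 0"
    then obtain m where m: "1 / Suc m < e" using nat_approx_posE by blast
    obtain n :: nat where "dist p x \<le> n" using real_arch_simple by blast
    then have "x \<in> cball p (real n)" by simp
    then have "x \<in> (\<Union>y\<in>k n m. ball y (1 / Suc m))" using k(2) by blast
    then obtain y where "y \<in> k n m" "dist y x < 1 / Suc m" by auto
    with m show "\<exists>y\<in>?D. dist y x < e" by (intro bexI[of _ y]) auto
  qed
  moreover have "countable ?D" using k(1) by (simp add: countable_finite)
  ultimately show ?thesis by blast
qed

text \<open>
  The Arzela-Ascoli theorem for normalised 1-Lipschitz functions: a diagonal subsequence
  converges on a countable dense set, and the common Lipschitz bound carries the convergence
  first to all points and then, through finite nets, uniformly to compact sets.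
\<close>

lemma lipschitz_convergent_subsequence:
  fixes h :: "nat \<Rightarrow> 'a::metric_space \<Rightarrow> real"
  assumes sep: "\<exists>D :: 'a set. countable D \<and> closure D = UNIV"
    and lip: "\<And>n. 1-lipschitz_on UNIV (h n)" and zero: "\<And>n. h n p = 0"
  shows "\<exists>l r. strict_mono (r :: nat \<Rightarrow> nat) \<and> 1-lipschitz_on UNIV l
    \<and> (\<forall>K. compact K \<longrightarrow> uniform_limit K (h \<circ> r) l sequentially)"
proof -
  from sep obtain D :: "'a set" where D: "countable D" "closure D = UNIV" by blast
  have L: "\<bar>h n x - h n y\<bar> \<le> dist x y" for n x y
    using lipschitz_onD[OF lip, of x y n] by (simp add: dist_real_def)
  \<comment> \<open>The diagonal argument is applied to functions with one bound for all points, which is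
    obtained by dividing by the linear growth allowed by the Lipschitz condition.\<close>
  have bd: "norm (h n x / (1 + dist x p)) \<le> 1" for n x
  proof -
    have "0 < 1 + dist x p" using zero_le_dist[of x p] by linarith
    moreover have "\<bar>h n x\<bar> \<le> dist x p" using L[of n x p] zero[of n] by simp
    ultimately show ?thesis by (simp add: divide_le_eq)
  qed
  obtain r where r: "strict_mono (r :: nat \<Rightarrow> nat)"
    and lim_D: "\<And>x. x \<in> D \<Longrightarrow> \<exists>l. (\<lambda>n. h (r n) x / (1 + dist x p)) \<longlonglongrightarrow> l"
    using function_convergent_subsequence[OF D(1), of "\<lambda>n x. h n x / (1 + dist x p)" 1, OF bd]
    by metis
  have conv_D: "convergent (\<lambda>n. h (r n) x)" if x: "x \<in> D" for x
  proof -
    obtain l where "(\<lambda>n. h (r n) x / (1 + dist x p)) \<longlonglongrightarrow> l" using lim_D[OF x] by blast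
    from tendsto_mult_right[OF this, of "1 + dist x p"]
    have "(\<lambda>n. h (r n) x / (1 + dist x p) * (1 + dist x p)) \<longlonglongrightarrow> l * (1 + dist x p)" .
    moreover have "1 + dist x p \<noteq> 0" using zero_le_dist[of x p] by linarith
    ultimately have "(\<lambda>n. h (r n) x) \<longlonglongrightarrow> l * (1 + dist x p)" by simp
    then show ?thesis by (rule convergentI)
  qed
  have "Cauchy (\<lambda>n. h (r n) x)" for x
  proof (rule metric_CauchyI)
    fix e :: real assume "e > 0"
    obtain q where q: "q \<in> D" "dist q x < e / 3"
      using D(2) \<open>e > 0\<close> closure_approachable[of x D, THEN iffD1, rule_format, of "e / 3"] by auto
    from conv_D[OF q(1)] have "Cauchy (\<lambda>n. h (r n) q)" by (rule convergent_Cauchy)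
    then obtain M where M: "\<And>m n. m \<ge> M \<Longrightarrow> n \<ge> M \<Longrightarrow> dist (h (r m) q) (h (r n) q) < e / 3"
      using metric_CauchyD[of _ "e / 3"] \<open>e > 0\<close> by fastforce
    have "dist (h (r m) x) (h (r n) x) < e" if "m \<ge> M" "n \<ge> M" for m n
      using M[OF that] L[of "r m" q x] L[of "r n" q x] q(2) unfolding dist_real_def by linarith
    then show "\<exists>M. \<forall>m\<ge>M. \<forall>n\<ge>M. dist (h (r m) x) (h (r n) x) < e" by blast
  qed
  then have "\<forall>x. \<exists>l. (\<lambda>n. h (r n) x) \<longlonglongrightarrow> l"
    using Cauchy_convergent convergent_def by blast
  then obtain l where l: "\<And>x. (\<lambda>n. h (r n) x) \<longlonglongrightarrow> l x" by metis
  have Ll: "\<bar>l x - l y\<bar> \<le> dist x y" for x y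
    by (rule LIMSEQ_le_const2[OF tendsto_rabs[OF tendsto_diff[OF l l]]]) (use L in blast)
  have "uniform_limit K (h \<circ> r) l sequentially" if K: "compact K" for K
  proof (rule uniform_limitI)
    fix e :: real assume "e > 0"
    obtain T where T: "finite T" "K \<subseteq> (\<Union>x\<in>T. ball x (e / 3))"
      using seq_compact_imp_totally_bounded[OF compact_imp_seq_compact[OF K], rule_format,
          of "e / 3"] \<open>e > 0\<close> by auto
    have "eventually (\<lambda>n. \<forall>t\<in>T. dist (h (r n) t) (l t) < e / 3) sequentially"
      using \<open>e > 0\<close> tendstoD[OF l, of "e / 3"]
      by (simp add: eventually_ball_finite_distrib[OF T(1)])
    then show "eventually (\<lambda>n. \<forall>x\<in>K. dist ((h \<circ> r) n x) (l x) < e) sequentially"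
    proof (rule eventually_mono, intro ballI)
      fix n x assume n: "\<forall>t\<in>T. dist (h (r n) t) (l t) < e / 3" and "x \<in> K"
      then obtain t where t: "t \<in> T" "dist t x < e / 3" using T(2) by auto
      from n t(1) have "dist (h (r n) t) (l t) < e / 3" by blast
      then show "dist ((h \<circ> r) n x) (l x) < e"
        using L[of "r n" t x] Ll[of t x] t(2) unfolding dist_real_def o_def by linarith
    qed
  qed
  moreover have "1-lipschitz_on UNIV l"
    using Ll by (auto simp: lipschitz_on_def dist_real_def)
  ultimately show ?thesis using r by blast
qed

text \<open>
  An increment of \<open>g\<close> exceeding the Lipschitz bound would give \<open>[g]\<close> a neighbourhood whose
  members all violate this bound, but distance functions satisfy it.
\<close>

lemma closure_metric_embedding_lipschitz:
  fixes p :: "'a::metric_space"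
  assumes "\<xi> \<in> cfun_quotient_topology closure_of range metric_embedding"
  obtains h where "\<xi> = cfun_class h" "1-lipschitz_on UNIV h" "h p = 0"
proof -
  from assms obtain g where g: "g \<in> cfun" "\<xi> = cfun_class g"
    by (auto simp: in_closure_of topspace_cfun_quotient)
  have le: "g x - g y \<le> dist x y" for x y
  proof (rule ccontr)
    assume "\<not> g x - g y \<le> dist x y"
    then have pos: "g x - g y - dist x y > 0" by simp
    have "\<xi> \<in> increment_nbhd y {x} (g x - g y - dist x y) g"
      using g pos by (simp add: cfun_class_in_increment_nbhd)
    then obtain z where "metric_embedding z \<in> increment_nbhd y {x} (g x - g y - dist x y) g"
      using assms openin_increment_nbhd[OF _ g(1), of "{x}"] unfolding in_closure_of by force
    then have "dist (dist z x - dist z y) (g x - g y) < g x - g y - dist x y"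
      by (simp add: metric_embedding_in_increment_nbhd)
    then show False
      using dist_triangle[of z x y] by (simp add: dist_real_def dist_commute)
  qed
  let ?h = "\<lambda>z. g z - g p"
  have "\<bar>?h x - ?h y\<bar> \<le> dist x y" for x y
    using le[of x y] le[of y x] by (simp add: dist_commute)
  then have lip: "1-lipschitz_on UNIV ?h" by (auto simp: lipschitz_on_def dist_real_def)
  moreover have "\<xi> = cfun_class ?h"
    using cfun_class_eq_iff[OF g(1) lipschitz_in_cfun[OF lip]] g(2)
    by (auto intro: exI[of _ "- g p"])
  ultimately show thesis using that by simp
qed

lemma topspace_metric_compactification:
  "topspace metric_compactification = cfun_quotient_topology closure_of range metric_embedding"
  unfolding metric_compactification_def topspace_subtopology
  by (rule Int_absorb1[OF closure_of_subset_topspace])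

lemma sequentially_compact_metric_compactification:
  assumes proper: "\<And>S :: 'a::metric_space set. closed S \<Longrightarrow> bounded S \<Longrightarrow> compact S"
  shows "sequentially_compact_space (metric_compactification :: ('a \<Rightarrow> real) set topology)"
  unfolding sequentially_compact_space_def
proof (intro allI impI)
  let ?C = "cfun_quotient_topology closure_of range (metric_embedding :: 'a \<Rightarrow> _)"
  fix s :: "nat \<Rightarrow> ('a \<Rightarrow> real) set"
  assume "\<forall>n. s n \<in> topspace metric_compactification"
  then have s: "s n \<in> ?C" for n by (simp add: topspace_metric_compactification)
  fix p :: 'a
  have "\<exists>h. s n = cfun_class h \<and> 1-lipschitz_on UNIV h \<and> h p = 0" for n
    by (rule closure_metric_embedding_lipschitz[OF s]) blast
  then obtain h where h: "\<And>n. s n = cfun_class (h n)" "\<And>n. 1-lipschitz_on UNIV (h n)"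
    "\<And>n. h n p = 0" by metis
  obtain l r where r: "strict_mono r" and l: "1-lipschitz_on UNIV l"
    and lim: "\<And>K. compact K \<Longrightarrow> uniform_limit K (h \<circ> r) l sequentially"
    using lipschitz_convergent_subsequence[of h p, OF proper_imp_separable[OF proper] h(2,3)]
    by blast
  have "limitin cfun_topology (h \<circ> r) l sequentially"
    using lim lipschitz_in_cfun[OF h(2)] lipschitz_in_cfun[OF l]
      limitin_cfun_topology[of "h \<circ> r" l sequentially] by simp
  from continuous_map_limit[OF quotient_imp_continuous_map[OF quotient_map_cfun_class] this]
  have lim: "limitin cfun_quotient_topology (s \<circ> r) (cfun_class l) sequentially"
    using h(1) by (simp add: o_def)
  then have "cfun_class l \<in> ?C"
    by (rule limitin_closedin) (use s in auto)
  then have "limitin metric_compactification (s \<circ> r) (cfun_class l) sequentially"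
    unfolding metric_compactification_def limitin_subtopology using lim s by simp
  with r show "\<exists>l r. strict_mono r \<and> limitin metric_compactification (s \<circ> r) l sequentially"
    by blast
qed

section \<open>Openness of the embedding\<close>

lemma geodesic_point_at_distance:
  fixes x y :: "'a::metric_space"
  assumes geodesic: "\<And>x y :: 'a. \<exists>a b \<sigma>. geodesic a b \<sigma> \<and> \<sigma> a = x \<and> \<sigma> b = y"
    and "0 \<le> r" "r \<le> dist x y"
  obtains z where "dist x z = r" "dist z y = dist x y - r"
proof -
  obtain a b \<sigma> where \<sigma>: "geodesic a b \<sigma>" "\<sigma> a = x" "\<sigma> b = y" using geodesic by blast
  then have ab: "a \<le> b" and iso: "\<And>s t. s \<in> {a..b} \<Longrightarrow> t \<in> {a..b} \<Longrightarrow> dist (\<sigma> s) (\<sigma> t) = \<bar>s - t\<bar>"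
    unfolding geodesic_def by auto
  have "dist x y = b - a" using iso[of a b] ab \<sigma> by simp
  then show thesis
    using that[of "\<sigma> (a + r)"] iso[of a "a + r"] iso[of "a + r" b] assms(2,3) ab \<sigma> by simp
qed

text \<open>
  Near \<open>[dist x]\<close> the compactification contains nothing but a ball of the space itself. For
  classes \<open>[dist y]\<close> this holds since the point \<open>z\<close> at distance \<open>r\<close> from \<open>x\<close> on a geodesic
  towards a distant \<open>y\<close> has increment \<open>r\<close> for \<open>dist x\<close> and \<open>- r\<close> for \<open>dist y\<close>. Limits of such
  classes are covered because the image of the closed ball is closed.
\<close>

lemma metric_compactification_local:
  fixes x :: "'a::metric_space"
  assumes proper: "\<And>S :: 'a set. closed S \<Longrightarrow> bounded S \<Longrightarrow> compact S"
    and geodesic: "\<And>x y :: 'a. \<exists>a b \<sigma>. geodesic a b \<sigma> \<and> \<sigma> a = x \<and> \<sigma> b = y"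
    and r: "r > 0"
  obtains W where "openin cfun_quotient_topology W" "metric_embedding x \<in> W"
    "W \<inter> cfun_quotient_topology closure_of range metric_embedding \<subseteq> metric_embedding ` cball x r"
proof -
  let ?Q = "cfun_quotient_topology :: ('a \<Rightarrow> real) set topology"
  let ?W = "increment_nbhd x (cball x r) r (dist x)"
  have op: "openin ?Q ?W"
    by (rule openin_increment_nbhd[OF _ dist_in_cfun]) (simp add: proper)
  have "y \<in> cball x r" if y: "metric_embedding y \<in> ?W" for y
  proof (rule ccontr)
    assume "y \<notin> cball x r"
    then obtain z where z: "dist x z = r" "dist z y = dist x y - r"
      using geodesic_point_at_distance[OF geodesic, of r x y] r by auto
    have "dist (dist y z - dist y x) (dist x z - dist x x) < r"
      using y unfolding metric_embedding_in_increment_nbhd by (rule bspec) (simp add: z(1))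
    with z r show False by (simp add: dist_real_def dist_commute)
  qed
  then have "?W \<inter> range metric_embedding \<subseteq> metric_embedding ` cball x r" by auto
  then have "?Q closure_of (?W \<inter> range metric_embedding) \<subseteq> metric_embedding ` cball x r"
    using closure_of_minimal closedin_metric_embedding_image[of "cball x r"] proper by simp
  then have "?W \<inter> ?Q closure_of range metric_embedding \<subseteq> metric_embedding ` cball x r"
    using openin_Int_closure_of_subset[OF op] by (rule order_trans[rotated])
  moreover have "metric_embedding x \<in> ?W"
    using r by (simp add: metric_embedding_in_increment_nbhd)
  ultimately show thesis using that op by blast
qed

lemma open_map_metric_embedding:
  assumes proper: "\<And>S :: 'a::metric_space set. closed S \<Longrightarrow> bounded S \<Longrightarrow> compact S"
    and geodesic: "\<And>x y :: 'a. \<exists>a b \<sigma>. geodesic a b \<sigma> \<and> \<sigma> a = x \<and> \<sigma> b = y"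
  shows "open_map euclidean metric_compactification (metric_embedding :: 'a \<Rightarrow> _)"
  unfolding open_map_def
proof (intro allI impI)
  let ?C = "cfun_quotient_topology closure_of range (metric_embedding :: 'a \<Rightarrow> _)"
  fix U :: "'a set" assume "openin euclidean U"
  then have "open U" by simp
  have emb: "metric_embedding x \<in> ?C" for x :: 'a
    using closure_of_subset[of "range metric_embedding" cfun_quotient_topology]
      continuous_map_image_subset_topspace[OF continuous_metric_embedding] by auto
  show "openin metric_compactification (metric_embedding ` U)"
  proof (subst openin_subopen, rule ballI)
    fix \<xi> assume "\<xi> \<in> metric_embedding ` U"
    then obtain x where x: "x \<in> U" "\<xi> = metric_embedding x" by blast
    then obtain r where r: "r > 0" "cball x r \<subseteq> U" using \<open>open U\<close> open_contains_cball by blast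
    obtain W where W: "openin cfun_quotient_topology W" "metric_embedding x \<in> W"
      "W \<inter> ?C \<subseteq> metric_embedding ` cball x r"
      by (rule metric_compactification_local[OF proper geodesic r(1)])
    have "openin metric_compactification (W \<inter> ?C)"
      unfolding metric_compactification_def openin_subtopology using W(1) by blast
    then show "\<exists>T. openin metric_compactification T \<and> \<xi> \<in> T \<and> T \<subseteq> metric_embedding ` U"
      using W(2,3) r(2) x(2) emb by (intro exI[of _ "W \<inter> ?C"]) auto
  qed
qed

lemma compactification_metric_compactification:
  assumes proper: "\<And>S :: 'a::metric_space set. closed S \<Longrightarrow> bounded S \<Longrightarrow> compact S"
    and geodesic: "\<And>x y :: 'a. \<exists>a b \<sigma>. geodesic a b \<sigma> \<and> \<sigma> a = x \<and> \<sigma> b = y"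
  shows "compactification metric_compactification (metric_embedding :: 'a \<Rightarrow> _)"
  unfolding compactification_def
proof (intro conjI)
  let ?R = "range (metric_embedding :: 'a \<Rightarrow> _)"
  have sub: "?R \<subseteq> cfun_quotient_topology closure_of ?R"
    using closure_of_subset[of ?R cfun_quotient_topology]
      continuous_map_image_subset_topspace[OF continuous_metric_embedding] by simp
  have opn: "open_map euclidean metric_compactification (metric_embedding :: 'a \<Rightarrow> _)"
    by (rule open_map_metric_embedding[OF proper geodesic])
  show "sequentially_compact_space (metric_compactification :: ('a \<Rightarrow> real) set topology)"
    by (rule sequentially_compact_metric_compactification[OF proper])
  show "Hausdorff_space (metric_compactification :: ('a \<Rightarrow> real) set topology)"
    unfolding metric_compactification_def
    by (rule Hausdorff_space_subtopology[OF Hausdorff_cfun_quotient])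
  have "continuous_map euclidean metric_compactification (metric_embedding :: 'a \<Rightarrow> _)"
    unfolding metric_compactification_def continuous_map_in_subtopology
    using continuous_metric_embedding sub by auto
  then show "embedding_map euclidean metric_compactification (metric_embedding :: 'a \<Rightarrow> _)"
    using opn inj_metric_embedding by (intro injective_open_imp_embedding_map) auto
  show "openin metric_compactification ?R"
    using opn unfolding open_map_def by simp
  show "metric_compactification closure_of ?R = topspace metric_compactification"
    unfolding topspace_metric_compactification
    using sub by (simp add: metric_compactification_def closure_of_subtopology Int_absorb1)
qed

section \<open>Geodesics with a common endpoint at infinity\<close>

text \<open>
  A unit step from \<open>z\<close> towards \<open>x\<close> stays in the ball of radius \<open>R + 1\<close> if \<open>dist p z \<le> R\<close>, and
  changes \<open>dist x\<close> by \<open>- 1\<close>. Comparing the change of \<open>dist y\<close> with it, via \<open>h\<close>, involves four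
  increments, so with precision \<open>1/4\<close> the two changes differ by less than \<open>1\<close> and \<open>dist y\<close>
  decreases too. This is impossible, since \<open>dist x + dist y\<close> has its minimum \<open>dist x y\<close> at \<open>z\<close>.
\<close>

lemma geodesic_between_close_increments_far:
  fixes p :: "'a::metric_space"
  assumes geodesic: "\<And>x y :: 'a. \<exists>a b \<sigma>. geodesic a b \<sigma> \<and> \<sigma> a = x \<and> \<sigma> b = y"
    and x: "metric_embedding x \<in> increment_nbhd p (cball p (R + 1)) (1/4) h"
    and y: "metric_embedding y \<in> increment_nbhd p (cball p (R + 1)) (1/4) h"
    and far: "dist p x > R + 1"
    and z: "dist x z + dist z y = dist x y"
  shows "dist p z > R"
proof (rule ccontr)
  assume "\<not> dist p z > R"
  then have zR: "dist p z \<le> R" by simp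
  then have "1 \<le> dist z x" using far dist_triangle[of p x z] by simp
  then obtain w where w: "dist z w = 1" "dist w x = dist z x - 1"
    using geodesic_point_at_distance[OF geodesic, of 1 z x] by auto
  have "z \<in> cball p (R + 1)" "w \<in> cball p (R + 1)"
    using zR w(1) dist_triangle[of p w z] by simp_all
  then have "dist (dist x z - dist x p) (h z - h p) < 1/4"
    "dist (dist x w - dist x p) (h w - h p) < 1/4"
    "dist (dist y z - dist y p) (h z - h p) < 1/4"
    "dist (dist y w - dist y p) (h w - h p) < 1/4"
    using x y unfolding metric_embedding_in_increment_nbhd by blast+
  then have "(dist y w - dist y z) - (dist x w - dist x z) < 1"
    unfolding dist_real_def by linarith
  moreover have "dist x w - dist x z = - 1" using w(2) by (simp add: dist_commute)
  ultimately have "dist x w + dist w y < dist x y" using z by (simp add: dist_commute)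
  with dist_triangle[of x y w] show False by simp
qed

theorem proposition1p3:
  assumes proper: "\<And>S :: 'a::metric_space set. closed S \<Longrightarrow> bounded S \<Longrightarrow> compact S"
    and geodesic: "\<And>x y :: 'a. \<exists>a b \<sigma>. geodesic a b \<sigma> \<and> \<sigma> a = x \<and> \<sigma> b = y"
  shows "good_compactification metric_compactification (metric_embedding :: 'a \<Rightarrow> ('a \<Rightarrow> real) set)"
  unfolding good_compactification_def
proof (intro conjI allI impI)
  show "compactification metric_compactification (metric_embedding :: 'a \<Rightarrow> _)"
    by (rule compactification_metric_compactification[OF proper geodesic])
next
  let ?Q = "cfun_quotient_topology :: ('a \<Rightarrow> real) set topology"
  fix a b :: "nat \<Rightarrow> real" and \<sigma> :: "nat \<Rightarrow> real \<Rightarrow> 'a" and \<xi> and p :: 'a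
  assume "(\<forall>n. geodesic (a n) (b n) (\<sigma> n)) \<and>
    limitin metric_compactification (\<lambda>n. metric_embedding (\<sigma> n (a n))) \<xi> sequentially \<and>
    limitin metric_compactification (\<lambda>n. metric_embedding (\<sigma> n (b n))) \<xi> sequentially \<and>
    \<xi> \<in> topspace metric_compactification - range metric_embedding"
  then have \<sigma>: "\<And>n. geodesic (a n) (b n) (\<sigma> n)"
    and lim: "limitin ?Q (\<lambda>n. metric_embedding (\<sigma> n (a n))) \<xi> sequentially"
      "limitin ?Q (\<lambda>n. metric_embedding (\<sigma> n (b n))) \<xi> sequentially"
    and \<xi>: "\<xi> \<in> topspace ?Q" "\<xi> \<notin> range metric_embedding"
    unfolding metric_compactification_def limitin_subtopology by auto
  from \<xi>(1) obtain h where h: "h \<in> cfun" "\<xi> = cfun_class h"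
    unfolding topspace_cfun_quotient by auto
  have far: "eventually (\<lambda>n. ereal R \<le> ereal (INF t\<in>{a n..b n}. dist p (\<sigma> n t))) sequentially"
    for R :: real
  proof -
    let ?W = "increment_nbhd p (cball p (R + 1)) (1/4) h"
    \<comment> \<open>A neighbourhood of \<open>\<xi>\<close> that forces \<open>\<sigma> n (a n)\<close> out of the ball; here it matters that
      \<open>\<xi>\<close> lies at infinity.\<close>
    let ?V = "topspace ?Q - metric_embedding ` cball p (R + 1)"
    have cpt: "compact (cball p (R + 1))" by (simp add: proper)
    have W: "openin ?Q ?W" "\<xi> \<in> ?W"
      using openin_increment_nbhd[OF cpt h(1)] h by (auto simp: cfun_class_in_increment_nbhd)
    have V: "openin ?Q ?V" "\<xi> \<in> ?V"
      using closedin_metric_embedding_image[OF cpt] \<xi> by (auto intro: openin_diff)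
    have "eventually (\<lambda>n. metric_embedding (\<sigma> n (a n)) \<in> ?W) sequentially"
      "eventually (\<lambda>n. metric_embedding (\<sigma> n (b n)) \<in> ?W) sequentially"
      "eventually (\<lambda>n. metric_embedding (\<sigma> n (a n)) \<in> ?V) sequentially"
      using lim W V unfolding limitin_def by blast+
    then show ?thesis
    proof eventually_elim
      case (elim n)
      have ab: "a n \<le> b n"
        and iso: "\<And>s t. s \<in> {a n..b n} \<Longrightarrow> t \<in> {a n..b n} \<Longrightarrow> dist (\<sigma> n s) (\<sigma> n t) = \<bar>s - t\<bar>"
        using \<sigma>[of n] unfolding geodesic_def by auto
      have "R \<le> dist p (\<sigma> n t)" if "t \<in> {a n..b n}" for t
      proof (rule less_imp_le, rule geodesic_between_close_increments_far[OF geodesic elim(1,2)])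
        show "dist p (\<sigma> n (a n)) > R + 1" using elim(3) by (auto simp: not_le[symmetric])
        show "dist (\<sigma> n (a n)) (\<sigma> n t) + dist (\<sigma> n t) (\<sigma> n (b n)) = dist (\<sigma> n (a n)) (\<sigma> n (b n))"
          using iso[of "a n" t] iso[of t "b n"] iso[of "a n" "b n"] that ab by simp
      qed
      then have "R \<le> (INF t\<in>{a n..b n}. dist p (\<sigma> n t))"
        using ab by (intro cINF_greatest) auto
      then show ?case by simp
    qed
  qed
  have "ereal R \<le> liminf (\<lambda>n. ereal (INF t\<in>{a n..b n}. dist p (\<sigma> n t)))" for R
    by (rule Liminf_bounded[OF far])
  then show "liminf (\<lambda>n. ereal (INF t\<in>{a n..b n}. dist p (\<sigma> n t))) = \<infinity>"
    by (intro ereal_top) 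
qed

end
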